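(* Let $\mathfrak{K}$ be a finite family of (pairwise non-isomorphic) computable structures. If $\mathfrak{K}$ is learnable, then $\mathfrak{K}$ is learnable by a $\mathbf{0}'$-computable learner.
   Context: Structures. All structures considered are in a relational signature, i.e. a signature with no function symbols (the members of a family share one signature), and have as domain the set $\omega$ of natural numbers. A structure is identified with its atomic diagram (the collection of atomic formulas true of it), regarded via a Gödel numbering as a subset of $\omega$; it is computable if this set is computable. Two structures are copies of each other if they are isomorphic. For a structure $\mathcal{S}$ and $n\in\omega$, $\mathcal{S}\restriction_n$ denotes the finite substructure obtained by restricting $\mathcal{S}$ to the domain $\{0,1,\ldots,n\}$. Learning. Let $\mathfrak{K}$ be a finite family of pairwise non-isomorphic computable structures. - The learning domain is the collection of all copies of the structures from $\mathfrak{K}$: $\mathrm{LD}(\mathfrak{K})=\bigcup_{\mathcal{A}\in\mathfrak{K}}\{\mathcal{S} : \mathcal{S}\cong\mathcal{A}\}$. - The hypothesis space is $\mathrm{HS}(\mathfrak{K})=\{\ulcorner\mathcal{A}\urcorner : \mathcal{A}\in\mathfrak{K}\}\cup\{?\}$, which contains one formal symbol $\ulcorner\mathcal{A}\urcorner$ for each $\mathcal{A}\in\mathfrak{K}$ (a conjecture about the isomorphism type of the observed structure) and a question mark symbol. - A learner sees, by stages, all positive and negative data about a given structure in the learning domain and outputs conjectures; formally, it is a function $M$ from $\{\mathcal{S}\restriction_n : \mathcal{S}\in\mathrm{LD}(\mathfrak{K}),\ n\in\omega\}$ to $\mathrm{HS}(\mathfrak{K})$. In general $M$ can be a function of any complexity.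 - $M$ learns $\mathfrak{K}$ if for every $\mathcal{S}\in\mathrm{LD}(\mathfrak{K})$ and every $\mathcal{A}\in\mathfrak{K}$: $\lim_{n\to\infty}M(\mathcal{S}\restriction_n)=\ulcorner\mathcal{A}\urcorner$ (i.e. $M(\mathcal{S}\restriction_n)=\ulcorner\mathcal{A}\urcorner$ for all sufficiently large $n$) if and only if $\mathcal{S}$ is a copy of $\mathcal{A}$. - $\mathfrak{K}$ is learnable if some learner learns $\mathfrak{K}$; it is learnable by a $\mathbf{0}'$-computable learner if some learner that learns $\mathfrak{K}$ is computable with an oracle for the Halting set $\emptyset'$, whose Turing degree is $\mathbf{0}'$. *)

theory Defs
  imports Main "HOL-Library.Nat_Bijection"
begin

section \<open>Relative computability\<close>

text \<open>Kleene's partial recursive functions with a query instruction for a set \<open>X\<close> of natural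
  numbers. The semantics is a relation: \<open>run X p xs y\<close> says that the program \<open>p\<close>, with \<open>X\<close> as
  external source, halts on the arguments \<open>xs\<close> with value \<open>y\<close>. In \<open>Pr\<close> the recursion runs over
  the first argument, and \<open>Mu\<close> requires all earlier values to be defined and nonzero.\<close>

datatype recf =
    Zero | Succ | Query | Proj nat
  | Comp recf "recf list" | Pr recf recf | Mu recf

inductive run :: "nat set \<Rightarrow> recf \<Rightarrow> nat list \<Rightarrow> nat \<Rightarrow> bool" for X :: "nat set" where
  run_Zero: "run X Zero xs 0"
| run_Succ: "run X Succ [x] (Suc x)"
| run_Query: "run X Query [x] (if x \<in> X then 1 else 0)"
| run_Proj: "i < length xs \<Longrightarrow> run X (Proj i) xs (xs ! i)"
| run_Comp: "list_all2 (\<lambda>q. run X q xs) qs ys \<Longrightarrow> run X p ys z \<Longrightarrow> run X (Comp p qs) xs z"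
| run_Pr_0: "run X p xs y \<Longrightarrow> run X (Pr p q) (0 # xs) y"
| run_Pr_Suc: "run X (Pr p q) (n # xs) y \<Longrightarrow> run X q (n # y # xs) z
    \<Longrightarrow> run X (Pr p q) (Suc n # xs) z"
| run_Mu: "run X p (n # xs) 0 \<Longrightarrow> (\<And>m. m < n \<Longrightarrow> \<exists>k. run X p (m # xs) (Suc k))
    \<Longrightarrow> run X (Mu p) xs n"
  monos list_all2_mono

inductive_cases run_elims:
  "run X Zero xs y" "run X Succ xs y" "run X Query xs y" "run X (Proj i) xs y"
  "run X (Pr p q) (0 # xs) y"

inductive_cases run_CompE: "run X (Comp p qs) xs y"
inductive_cases run_PrE: "run X (Pr p q) (Suc n # xs) y"
inductive_cases run_MuE: "run X (Mu p) xs y"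

lemma run_deterministic: "run X p xs y \<Longrightarrow> run X p xs z \<Longrightarrow> y = z"
proof (induction arbitrary: z rule: run.induct)
  case (run_Comp xs qs ys p w)
  from run_Comp.prems obtain ys' where ys': "list_all2 (\<lambda>q. run X q xs) qs ys'" "run X p ys' z"
    by (rule run_CompE)
  have "ys = ys'"
  proof (rule nth_equalityI)
    show "length ys = length ys'"
      using run_Comp.IH(1) ys'(1) by (simp add: list_all2_conv_all_nth)
  next
    fix i assume "i < length ys"
    then show "ys ! i = ys' ! i"
      using run_Comp.IH(1) ys'(1) by (simp add: list_all2_conv_all_nth)
  qed
  then show ?case
    using run_Comp.IH(2) ys'(2) by simp
next
  case (run_Pr_Suc p q n xs y w)
  from run_Pr_Suc.prems obtain y' where "run X (Pr p q) (n # xs) y'" "run X q (n # y' # xs) z"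
    by (rule run_PrE)
  then show ?case
    using run_Pr_Suc.IH by blast
next
  case (run_Mu p n xs)
  from run_Mu.prems have z: "run X p (z # xs) 0" "\<And>m. m < z \<Longrightarrow> \<exists>k. run X p (m # xs) (Suc k)"
    by (blast elim: run_MuE)+
  have "\<not> z < n"
    using run_Mu.IH(2) z(1) by blast
  moreover have "\<not> n < z"
    using run_Mu.IH(1) z(2) by blast
  ultimately show ?case
    by simp
qed (blast elim: run_elims)+

fun recf_code :: "recf \<Rightarrow> nat" where
  "recf_code Zero = prod_encode (0, 0)"
| "recf_code Succ = prod_encode (1, 0)"
| "recf_code Query = prod_encode (2, 0)"
| "recf_code (Proj i) = prod_encode (3, i)"
| "recf_code (Comp p qs) = prod_encode (4, prod_encode (recf_code p, list_encode (map recf_code qs)))"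
| "recf_code (Pr p q) = prod_encode (5, prod_encode (recf_code p, recf_code q))"
| "recf_code (Mu p) = prod_encode (6, recf_code p)"

definition halting_set :: "nat set" where
  "halting_set = {prod_encode (recf_code p, x) | p x. \<exists>y. run {} p [x] y}"

definition computable_fun :: "(nat \<Rightarrow> nat) \<Rightarrow> bool" where
  "computable_fun f \<longleftrightarrow> (\<exists>p. \<forall>x. run {} p [x] (f x))"

definition computable_set :: "nat set \<Rightarrow> bool" where
  "computable_set D \<longleftrightarrow> computable_fun (\<lambda>x. if x \<in> D then 1 else 0)"


section \<open>Structures with domain the natural numbers\<close>

text \<open>A relational signature assigns an arity to each of its symbols; the symbols are the
  natural numbers \<open>i\<close> with \<open>L i \<noteq> None\<close>. It may be finite or countably infinite.\<close>

type_synonym rel_signature = "nat \<Rightarrow> nat option"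

text \<open>The usual effectivity condition for Goedel numbering the atomic formulas. It is automatic
  for finite signatures.\<close>

definition computable_signature :: "rel_signature \<Rightarrow> bool" where
  "computable_signature L \<longleftrightarrow>
     computable_fun (\<lambda>i. case L i of None \<Rightarrow> 0 | Some k \<Rightarrow> Suc k)"

text \<open>The domain is always the type \<^typ>\<open>nat\<close>, so that a structure is the interpretation of its
  symbols as sets of tuples.\<close>

type_synonym struct = "nat \<Rightarrow> nat list set"

definition is_struct :: "rel_signature \<Rightarrow> struct \<Rightarrow> bool" where
  "is_struct L A \<longleftrightarrow> (\<forall>i. \<forall>xs \<in> A i. L i = Some (length xs))"

definition isomorphic :: "struct \<Rightarrow> struct \<Rightarrow> bool" (infix "\<cong>" 50) where
  "A \<cong> B \<longleftrightarrow> (\<exists>f. bij f \<and> (\<forall>i xs. xs \<in> A i \<longleftrightarrow> map f xs \<in> B i))"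

datatype atom = EqAtom nat nat | RelAtom nat "nat list"

fun atom_code :: "atom \<Rightarrow> nat" where
  "atom_code (EqAtom a b) = sum_encode (Inl (prod_encode (a, b)))"
| "atom_code (RelAtom i xs) = sum_encode (Inr (prod_encode (i, list_encode xs)))"

definition diagram :: "struct \<Rightarrow> atom set" where
  "diagram A = {EqAtom a a | a. True} \<union> {RelAtom i xs | i xs. xs \<in> A i}"

definition computable_struct :: "struct \<Rightarrow> bool" where
  "computable_struct A \<longleftrightarrow> computable_set (atom_code ` diagram A)"

text \<open>\<open>restr L A n\<close> is the finite substructure of \<open>A\<close> with domain \<open>{0, ..., n}\<close>, identified with
  its atomic diagram; the equality atoms in it determine the domain. If the signature is finite,
  all its symbols are kept. If it is infinite, only the symbols up to \<open>n\<close> are kept, so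
  that the restriction is a finite object that a machine can receive as input.\<close>

definition visible :: "rel_signature \<Rightarrow> nat \<Rightarrow> nat set" where
  "visible L n = (if finite (dom L) then dom L else dom L \<inter> {..n})"

definition restr :: "rel_signature \<Rightarrow> struct \<Rightarrow> nat \<Rightarrow> atom set" where
  "restr L A n = {EqAtom a a | a. a \<le> n}
     \<union> {RelAtom i xs | i xs. xs \<in> A i \<and> i \<in> visible L n \<and> set xs \<subseteq> {..n}}"

lemma restr_subset_diagram: "restr L A n \<subseteq> diagram A"
  by (auto simp: restr_def diagram_def)

lemma finite_restr:
  assumes "is_struct L A"
  shows "finite (restr L A n)"
proof -
  have "finite (visible L n)"
    by (simp add: visible_def)
  moreover have "finite {xs. set xs \<subseteq> {..n} \<and> length xs = k}" for k :: nat
    by (rule finite_lists_length_eq) simp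
  ultimately have "finite (\<Union>i\<in>visible L n. RelAtom i ` {xs. set xs \<subseteq> {..n} \<and> length xs = the (L i)})"
    by simp
  moreover have "{RelAtom i xs | i xs. xs \<in> A i \<and> i \<in> visible L n \<and> set xs \<subseteq> {..n}} \<subseteq>
      (\<Union>i\<in>visible L n. RelAtom i ` {xs. set xs \<subseteq> {..n} \<and> length xs = the (L i)})"
  proof clarify
    fix i xs assume *: "xs \<in> A i" "i \<in> visible L n" "set xs \<subseteq> {..n}"
    from *(1) assms have "L i = Some (length xs)"
      unfolding is_struct_def by blast
    with *(3) have "RelAtom i xs \<in> RelAtom i ` {xs. set xs \<subseteq> {..n} \<and> length xs = the (L i)}"
      by simp
    with *(2) show "RelAtom i xs \<in> (\<Union>i\<in>visible L n.
        RelAtom i ` {xs. set xs \<subseteq> {..n} \<and> length xs = the (L i)})"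
      by (rule UN_I)
  qed
  ultimately have "finite {RelAtom i xs | i xs. xs \<in> A i \<and> i \<in> visible L n \<and> set xs \<subseteq> {..n}}"
    by (rule rev_finite_subset)
  then show ?thesis
    by (simp add: restr_def)
qed

definition finite_struct_code :: "atom set \<Rightarrow> nat" where
  "finite_struct_code D = set_encode (atom_code ` D)"


section \<open>Learning\<close>

definition LD :: "struct set \<Rightarrow> struct set" where
  "LD K = (\<Union>A\<in>K. {S. S \<cong> A})"

text \<open>The formal symbol for \<open>A\<close> is \<open>Some A\<close>, and \<open>None\<close> is the question mark.\<close>

definition HS :: "struct set \<Rightarrow> struct option set" where
  "HS K = Some ` K \<union> {None}"

text \<open>Only the values of a learner on restrictions of members of the learning domain matter.\<close>

definition is_learner :: "rel_signature \<Rightarrow> struct set \<Rightarrow> (atom set \<Rightarrow> struct option) \<Rightarrow> bool" where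
  "is_learner L K M \<longleftrightarrow> (\<forall>S\<in>LD K. \<forall>n. M (restr L S n) \<in> HS K)"

definition learns :: "rel_signature \<Rightarrow> struct set \<Rightarrow> (atom set \<Rightarrow> struct option) \<Rightarrow> bool" where
  "learns L K M \<longleftrightarrow>
     (\<forall>S\<in>LD K. \<forall>A\<in>K. (\<forall>\<^sub>F n in sequentially. M (restr L S n) = Some A) \<longleftrightarrow> S \<cong> A)"

text \<open>The hypothesis space of a finite family is finite, so the choice of its numbering \<open>c\<close> is
  immaterial.\<close>

definition computable_learner_in ::
  "nat set \<Rightarrow> rel_signature \<Rightarrow> struct set \<Rightarrow> (atom set \<Rightarrow> struct option) \<Rightarrow> bool" where
  "computable_learner_in X L K M \<longleftrightarrow>
     (\<exists>c :: struct option \<Rightarrow> nat. inj_on c (HS K) \<and>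
       (\<exists>p. \<forall>S\<in>LD K. \<forall>n.
          run X p [finite_struct_code (restr L S n)] (c (M (restr L S n)))))"

definition learnable :: "rel_signature \<Rightarrow> struct set \<Rightarrow> bool" where
  "learnable L K \<longleftrightarrow> (\<exists>M. is_learner L K M \<and> learns L K M)"

definition learnable_by_computable_in :: "nat set \<Rightarrow> rel_signature \<Rightarrow> struct set \<Rightarrow> bool" where
  "learnable_by_computable_in X L K \<longleftrightarrow>
     (\<exists>M. is_learner L K M \<and> learns L K M \<and> computable_learner_in X L K M)"

end

theory Submission
  imports Defs
begin

text \<open>A learner \<open>M\<close> of the family has, for each member \<open>A\<close>, a locking condition: a finite tuple \<open>g\<close>
  in \<open>A\<close> such that \<open>M\<close> conjectures \<open>A\<close> on every finite substructure that embeds into \<open>A\<close> along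
  an extension of \<open>g\<close>; otherwise one could build a copy of \<open>A\<close> on which \<open>M\<close> is wrong infinitely
  often. Hence if a structure \<open>S\<close> of the learning domain contains a tuple \<open>c\<close> such that all finite
  parts of \<open>S\<close> embed into \<open>A\<close> with \<open>c\<close> going to \<open>g\<close>, then \<open>M\<close> converges to \<open>A\<close> on a copy of
  \<open>S\<close> that begins with \<open>c\<close>, so \<open>S\<close> is a copy of \<open>A\<close>. The new learner outputs the index of the first
  pair \<open>(A, c)\<close> that has not been refuted so far. Embeddability of a finite structure into a
  computable one is \<open>\<Sigma>\<^sub>1\<close>, so a single query to the halting set decides whether a pair is refuted.\<close>

section \<open>Total relatively computable functions\<close>

text \<open>Packing the arguments into one list gives all closure rules the same shape, so a program
  for a term over \<open>xs ! i\<close> is found by applying them backwards. Only lists of length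
  \<open>n\<close> count.\<close>

definition rcomp :: "nat set \<Rightarrow> nat \<Rightarrow> (nat list \<Rightarrow> nat) \<Rightarrow> bool" where
  "rcomp X n F \<longleftrightarrow> (\<exists>p. \<forall>xs. length xs = n \<longrightarrow> run X p xs (F xs))"

named_theorems rcomp_intros

lemma rcompE:
  assumes "rcomp X n F"
  obtains p where "\<And>xs. length xs = n \<Longrightarrow> run X p xs (F xs)"
  using assms unfolding rcomp_def by blast

lemma rcomp_1I:
  assumes "\<And>x. run X p [x] (f x)"
  shows "rcomp X 1 (\<lambda>xs. f (xs ! 0))"
  unfolding rcomp_def
proof (intro exI[of _ p] allI impI)
  fix xs :: "nat list" assume "length xs = 1"
  then obtain x where "xs = [x]"
    by (auto simp: length_Suc_conv)
  then show "run X p xs (f (xs ! 0))"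
    using assms by simp
qed

lemma rcomp_compose:
  assumes "rcomp X (length Fs) H" and "\<And>F. F \<in> set Fs \<Longrightarrow> rcomp X n F"
  shows "rcomp X n (\<lambda>xs. H (map (\<lambda>F. F xs) Fs))"
proof -
  obtain p where p: "\<And>ys. length ys = length Fs \<Longrightarrow> run X p ys (H ys)"
    using assms(1) by (rule rcompE) blast
  from assms(2) have "\<exists>qs. length qs = length Fs \<and>
      (\<forall>xs. length xs = n \<longrightarrow> list_all2 (\<lambda>q. run X q xs) qs (map (\<lambda>F. F xs) Fs))"
  proof (induction Fs)
    case (Cons F Fs)
    then obtain q qs where "\<And>xs. length xs = n \<Longrightarrow> run X q xs (F xs)" "length qs = length Fs"
      "\<forall>xs. length xs = n \<longrightarrow> list_all2 (\<lambda>q. run X q xs) qs (map (\<lambda>F. F xs) Fs)"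
      by (metis rcompE list.set_intros)
    then show ?case
      by (intro exI[of _ "q # qs"]) simp
  qed simp
  then obtain qs where qs: "\<And>xs. length xs = n \<Longrightarrow>
      list_all2 (\<lambda>q. run X q xs) qs (map (\<lambda>F. F xs) Fs)"
    by blast
  show ?thesis
    unfolding rcomp_def by (rule exI[of _ "Comp p qs"]) (auto intro!: run_Comp p qs)
qed

lemma rcomp_cong:
  assumes "\<And>xs. length xs = n \<Longrightarrow> F xs = G xs"
  shows "rcomp X n F \<longleftrightarrow> rcomp X n G"
  using assms by (auto simp: rcomp_def)

lemma rcomp_compose1:
  assumes "rcomp X 1 (\<lambda>xs. h (xs ! 0))" "rcomp X n F"
  shows "rcomp X n (\<lambda>xs. h (F xs))"
  using rcomp_compose[of X "[F]" "\<lambda>xs. h (xs ! 0)"] assms by simp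

lemma rcomp_compose2:
  assumes "rcomp X 2 (\<lambda>xs. h (xs ! 0) (xs ! 1))" "rcomp X n F" "rcomp X n G"
  shows "rcomp X n (\<lambda>xs. h (F xs) (G xs))"
  using rcomp_compose[of X "[F, G]" "\<lambda>xs. h (xs ! 0) (xs ! 1)" n] assms
  by (auto simp: numeral_2_eq_2)

lemma rcomp_compose3:
  assumes "rcomp X 3 (\<lambda>xs. h (xs ! 0) (xs ! 1) (xs ! 2))" "rcomp X n F" "rcomp X n G" "rcomp X n H"
  shows "rcomp X n (\<lambda>xs. h (F xs) (G xs) (H xs))"
  using rcomp_compose[of X "[F, G, H]" "\<lambda>xs. h (xs ! 0) (xs ! 1) (xs ! 2)" n] assms
  by (auto simp: numeral_3_eq_3 numeral_2_eq_2)

lemma rcomp_nth [rcomp_intros]: "i < n \<Longrightarrow> rcomp X n (\<lambda>xs. xs ! i)"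
  unfolding rcomp_def by (auto intro!: exI[of _ "Proj i"] run_Proj)

lemma rcomp_Suc [rcomp_intros]:
  assumes "rcomp X n F"
  shows "rcomp X n (\<lambda>xs. Suc (F xs))"
proof (rule rcomp_compose1[OF _ assms])
  show "rcomp X 1 (\<lambda>xs. Suc (xs ! 0))"
    by (rule rcomp_1I[OF run_Succ])
qed

lemma rcomp_const [rcomp_intros]: "rcomp X n (\<lambda>_. k)"
proof (induction k)
  case 0
  show ?case
    unfolding rcomp_def by (auto intro: run_Zero)
qed (rule rcomp_Suc)

lemma rcomp_rec_nat:
  assumes "rcomp X n F" "rcomp X (Suc (Suc n)) G"
  shows "rcomp X (Suc n) (\<lambda>xs. rec_nat (F (tl xs)) (\<lambda>j y. G (j # y # tl xs)) (hd xs))"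
proof -
  from assms(1) obtain p where p: "\<And>xs. length xs = n \<Longrightarrow> run X p xs (F xs)"
    by (rule rcompE) blast
  from assms(2) obtain q where q: "\<And>xs. length xs = Suc (Suc n) \<Longrightarrow> run X q xs (G xs)"
    by (rule rcompE) blast
  have "run X (Pr p q) (j # xs) (rec_nat (F xs) (\<lambda>j y. G (j # y # xs)) j)"
    if "length xs = n" for j xs
  proof (induction j)
    case (Suc j)
    show ?case
      using run_Pr_Suc[OF Suc q] that by simp
  qed (simp add: run_Pr_0 p that)
  then show ?thesis
    unfolding rcomp_def by (intro exI[of _ "Pr p q"]) (auto simp: length_Suc_conv)
qed

lemma rcomp_prim_rec1:
  assumes "rcomp X 2 (\<lambda>ys. g (ys ! 0) (ys ! 1))" "\<And>j. h (Suc j) = g j (h j)"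
  shows "rcomp X 1 (\<lambda>xs. h (xs ! 0))"
proof -
  have "rec_nat (h 0) g j = h j" for j
    by (induction j) (simp_all add: assms(2))
  moreover have "rcomp X 1 (\<lambda>xs. rec_nat (h 0) g (hd xs))"
    using rcomp_rec_nat[OF rcomp_const[of X 0 "h 0"], of "\<lambda>ys. g (ys ! 0) (ys ! 1)"] assms(1)
    by (simp add: numeral_2_eq_2)
  ultimately show ?thesis
    by (subst rcomp_cong[of _ _ "\<lambda>xs. rec_nat (h 0) g (hd xs)"]) (auto simp: length_Suc_conv)
qed

lemma rcomp_prim_rec2:
  assumes "rcomp X 1 (\<lambda>xs. h 0 (xs ! 0))" "rcomp X 3 (\<lambda>ys. g (ys ! 0) (ys ! 1) (ys ! 2))"
    "\<And>j b. h (Suc j) b = g j (h j b) b"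
  shows "rcomp X 2 (\<lambda>xs. h (xs ! 0) (xs ! 1))"
proof -
  have "rec_nat (h 0 b) (\<lambda>j y. g j y b) j = h j b" for j b
    by (induction j) (simp_all add: assms(3))
  moreover have "rcomp X 2 (\<lambda>xs. rec_nat (h 0 (tl xs ! 0)) (\<lambda>j y. g j y (tl xs ! 0)) (hd xs))"
    using rcomp_rec_nat[OF assms(1), of "\<lambda>ys. g (ys ! 0) (ys ! 1) (ys ! 2)"] assms(2)
    by (simp add: numeral_2_eq_2 numeral_3_eq_3)
  ultimately show ?thesis
    by (subst rcomp_cong[of _ _
          "\<lambda>xs. rec_nat (h 0 (tl xs ! 0)) (\<lambda>j y. g j y (tl xs ! 0)) (hd xs)"])
       (auto simp: hd_conv_nth nth_tl eval_nat_numeral simp flip: length_greater_0_conv)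
qed

lemma rcomp_prim_rec3:
  assumes "rcomp X 2 (\<lambda>xs. h 0 (xs ! 0) (xs ! 1))"
    "rcomp X 4 (\<lambda>ys. g (ys ! 0) (ys ! 1) (ys ! 2) (ys ! 3))"
    "\<And>j b c. h (Suc j) b c = g j (h j b c) b c"
  shows "rcomp X 3 (\<lambda>xs. h (xs ! 0) (xs ! 1) (xs ! 2))"
proof -
  have "rec_nat (h 0 b c) (\<lambda>j y. g j y b c) j = h j b c" for j b c
    by (induction j) (simp_all add: assms(3))
  moreover have "rcomp X 3 (\<lambda>xs. rec_nat (h 0 (tl xs ! 0) (tl xs ! 1))
      (\<lambda>j y. g j y (tl xs ! 0) (tl xs ! 1)) (hd xs))"
    using rcomp_rec_nat[OF assms(1), of "\<lambda>ys. g (ys ! 0) (ys ! 1) (ys ! 2) (ys ! 3)"] assms(2)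
    by (simp add: eval_nat_numeral)
  ultimately show ?thesis
    by (subst rcomp_cong[of _ _ "\<lambda>xs. rec_nat (h 0 (tl xs ! 0) (tl xs ! 1))
      (\<lambda>j y. g j y (tl xs ! 0) (tl xs ! 1)) (hd xs)"])
       (auto simp: hd_conv_nth nth_tl eval_nat_numeral simp flip: length_greater_0_conv)
qed

section \<open>Arithmetic, case distinctions and bounded sums\<close>

lemma rcomp_add [rcomp_intros]:
  assumes "rcomp X n F" "rcomp X n G"
  shows "rcomp X n (\<lambda>xs. F xs + G xs)"
proof (rule rcomp_compose2[OF _ assms])
  show "rcomp X 2 (\<lambda>xs. xs ! 0 + xs ! 1)"
    by (rule rcomp_prim_rec2[where g = "\<lambda>j y b. Suc y"]) (simp_all add: rcomp_intros)
qed

lemma rcomp_mult [rcomp_intros]: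
  assumes "rcomp X n F" "rcomp X n G"
  shows "rcomp X n (\<lambda>xs. F xs * G xs)"
proof (rule rcomp_compose2[OF _ assms])
  show "rcomp X 2 (\<lambda>xs. xs ! 0 * xs ! 1)"
    by (rule rcomp_prim_rec2[where g = "\<lambda>j y b. b + y"]) (simp_all add: rcomp_intros)
qed

lemma rcomp_diff [rcomp_intros]:
  assumes "rcomp X n F" "rcomp X n G"
  shows "rcomp X n (\<lambda>xs. F xs - G xs)"
proof (rule rcomp_compose2[where h = "\<lambda>b a. a - b", OF _ assms(2,1)])
  have pred: "rcomp X 1 (\<lambda>xs. xs ! 0 - 1)"
    by (rule rcomp_prim_rec1[where g = "\<lambda>j y. j"]) (simp_all add: rcomp_intros)
  show "rcomp X 2 (\<lambda>xs. xs ! 1 - xs ! 0)"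
    by (rule rcomp_prim_rec2[where h = "\<lambda>b a. a - b" and g = "\<lambda>j y b. y - 1"])
       (simp_all add: rcomp_intros rcomp_compose1[where h = "\<lambda>z. z - 1", OF pred, simplified])
qed

lemma rcomp_if_zero [rcomp_intros]:
  assumes "rcomp X n F" "rcomp X n G" "rcomp X n H"
  shows "rcomp X n (\<lambda>xs. if F xs = 0 then G xs else H xs)"
proof -
  \<comment> \<open>Truncated subtraction makes \<open>1 - F xs\<close> the indicator of
    \<open>F xs = 0\<close> and \<open>1 - (1 - F xs)\<close> that of its negation.\<close>
  have "rcomp X n (\<lambda>xs. (1 - F xs) * G xs + (1 - (1 - F xs)) * H xs)"
    by (intro rcomp_intros assms)
  also have "(\<lambda>xs. (1 - F xs) * G xs + (1 - (1 - F xs)) * H xs) =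
      (\<lambda>xs. if F xs = 0 then G xs else H xs)"
    by auto
  finally show ?thesis .
qed

lemma rcomp_if_eq [rcomp_intros]:
  assumes "rcomp X n F1" "rcomp X n F2" "rcomp X n G" "rcomp X n H"
  shows "rcomp X n (\<lambda>xs. if F1 xs = F2 xs then G xs else H xs)"
proof -
  have "rcomp X n (\<lambda>xs. if (F1 xs - F2 xs) + (F2 xs - F1 xs) = 0 then G xs else H xs)"
    by (intro rcomp_intros assms)
  also have "(\<lambda>xs. if (F1 xs - F2 xs) + (F2 xs - F1 xs) = 0 then G xs else H xs) =
      (\<lambda>xs. if F1 xs = F2 xs then G xs else H xs)"
    by fastforce
  finally show ?thesis .
qed

lemma rcomp_sum:
  assumes "rcomp X n B" "rcomp X (Suc n) F"
  shows "rcomp X n (\<lambda>xs. \<Sum>e<B xs. F (e # xs))"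
proof -
  \<comment> \<open>The recursion step receives the counter, the partial sum and then the
    parameters; the \<open>map\<close> skips the partial sum, which is no argument of
    \<open>F\<close>.\<close>
  have G: "rcomp X (Suc (Suc n)) (\<lambda>ys. ys ! 1 + F (ys ! 0 # map (\<lambda>i. ys ! (i + 2)) [0..<n]))"
  proof (intro rcomp_intros)
    have "rcomp X (Suc (Suc n)) (\<lambda>ys. F (map (\<lambda>F. F ys)
        ((\<lambda>ys. ys ! 0) # map (\<lambda>i ys. ys ! (i + 2)) [0..<n])))"
      by (rule rcomp_compose) (auto intro!: rcomp_intros assms(2))
    then show "rcomp X (Suc (Suc n)) (\<lambda>ys. F (ys ! 0 # map (\<lambda>i. ys ! (i + 2)) [0..<n]))"
      by (simp add: comp_def)
  qed simp
  have map_id: "map (\<lambda>i. xs ! i) [0..<n] = xs" if "length xs = n" for xs :: "nat list"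
    using that map_nth by blast
  have rec: "rcomp X (Suc n) (\<lambda>xs. rec_nat 0 (\<lambda>j y. y + F (j # map ((!) (tl xs)) [0..<n])) (hd xs))"
    using rcomp_rec_nat[OF rcomp_const[of X n 0] G] by simp
  have "rcomp X n (\<lambda>xs. (\<lambda>xs. rec_nat 0 (\<lambda>j y. y + F (j # map ((!) (tl xs)) [0..<n])) (hd xs))
      (map (\<lambda>F. F xs) (B # map (\<lambda>i xs. xs ! i) [0..<n])))"
    by (rule rcomp_compose) (auto intro!: rcomp_intros assms(1) rec)
  then have "rcomp X n (\<lambda>xs. rec_nat 0 (\<lambda>j y. y + F (j # map ((!) (map ((!) xs) [0..<n])) [0..<n])) (B xs))"
    by (simp add: comp_def)
  moreover have "rec_nat 0 (\<lambda>j y. y + F (j # map ((!) (map ((!) xs) [0..<n])) [0..<n])) b =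
      (\<Sum>e<b. F (e # xs))" if "length xs = n" for xs b
    by (induction b) (simp_all add: map_id that)
  ultimately show ?thesis
    by (subst rcomp_cong) auto
qed

lemma rcomp_triangle [rcomp_intros]:
  assumes "rcomp X n F"
  shows "rcomp X n (\<lambda>xs. triangle (F xs))"
proof (rule rcomp_compose1[OF _ assms])
  show "rcomp X 1 (\<lambda>xs. triangle (xs ! 0))"
    by (rule rcomp_prim_rec1[where g = "\<lambda>j y. y + Suc j"]) (simp_all add: rcomp_intros)
qed

lemma rcomp_prod_encode [rcomp_intros]:
  assumes "rcomp X n F" "rcomp X n G"
  shows "rcomp X n (\<lambda>xs. prod_encode (F xs, G xs))"
  unfolding prod_encode_def by (simp, intro rcomp_intros assms)

section \<open>Unbounded search and inverses of pairing\<close>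

lemma run_Mu_total:
  assumes "\<And>m. run X p (m # xs) (F m)"
  shows "run X (Mu p) xs y \<longleftrightarrow> F y = 0 \<and> (\<forall>m<y. F m \<noteq> 0)"
proof
  assume "run X (Mu p) xs y"
  then have *: "run X p (y # xs) 0" "\<And>m. m < y \<Longrightarrow> \<exists>k. run X p (m # xs) (Suc k)"
    by (blast elim: run_MuE)+
  have "F m \<noteq> 0" if "m < y" for m
    using *(2)[OF that] run_deterministic[OF assms] by fastforce
  then show "F y = 0 \<and> (\<forall>m<y. F m \<noteq> 0)"
    using run_deterministic[OF assms *(1)] by simp
next
  assume y: "F y = 0 \<and> (\<forall>m<y. F m \<noteq> 0)"
  show "run X (Mu p) xs y"
    by (rule run_Mu) (metis y assms not0_implies_Suc)+
qed

lemma run_Mu_Least: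
  assumes "\<And>m. run X p (m # xs) (F m)" and "\<exists>n. F n = 0"
  shows "run X (Mu p) xs (LEAST m. F m = 0)"
proof -
  have "F (LEAST m. F m = 0) = 0"
    using assms(2) by (rule LeastI_ex)
  moreover have "F m \<noteq> 0" if "m < (LEAST m. F m = 0)" for m
    using that by (rule not_less_Least)
  ultimately show ?thesis
    using run_Mu_total[where F = F, OF assms(1)] by blast
qed

text \<open>The pairs with sum \<open>s\<close> have the codes from \<open>triangle s\<close> to
  \<open>triangle s + s\<close>. So the least \<open>s\<close> with
  \<open>z < triangle (Suc s)\<close> is the sum of the two components, and subtractions then yield
  both.\<close>

lemma rcomp_prod_decode:
  "rcomp X 1 (\<lambda>xs. fst (prod_decode (xs ! 0)))" "rcomp X 1 (\<lambda>xs. snd (prod_decode (xs ! 0)))"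
proof -
  define root where "root z = (LEAST s. Suc z - triangle (Suc s) = 0)" for z
  have root: "root (prod_encode (a, b)) = a + b" for a b
    unfolding root_def
  proof (rule Least_equality)
    fix s assume s: "Suc (prod_encode (a, b)) - triangle (Suc s) = 0"
    show "a + b \<le> s"
    proof (rule ccontr)
      assume "\<not> a + b \<le> s"
      then have "triangle (Suc s) \<le> triangle (a + b)"
        unfolding triangle_def by (intro div_le_mono mult_le_mono) auto
      with s show False
        by (simp add: prod_encode_def)
    qed
  qed (simp add: prod_encode_def)
  have "rcomp X 2 (\<lambda>ys. Suc (ys ! 1) - triangle (Suc (ys ! 0)))"
    by (intro rcomp_intros) simp_all
  then obtain p where p: "\<And>xs. length xs = 2 \<Longrightarrow> run X p xs (Suc (xs ! 1) - triangle (Suc (xs ! 0)))"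
    by (rule rcompE) blast
  have "run X (Mu p) [z] (root z)" for z
  proof -
    have "run X p (s # [z]) (Suc z - triangle (Suc s))" for s
      using p[of "[s, z]"] by (simp del: triangle_Suc)
    moreover have "\<exists>s. Suc z - triangle (Suc s) = 0"
      by (metis diff_is_0_eq' le_add2 le_SucI Suc_le_mono add_Suc_right triangle_Suc)
    ultimately show ?thesis
      unfolding root_def by (rule run_Mu_Least[where F = "\<lambda>s. Suc z - triangle (Suc s)"])
  qed
  then have "rcomp X 1 (\<lambda>xs. root (xs ! 0))"
    by (rule rcomp_1I)
  note r = rcomp_compose1[OF this]
  have decode: "fst (prod_decode z) = z - triangle (root z)"
    "snd (prod_decode z) = root z - fst (prod_decode z)" for z
  proof -
    obtain a b where z: "prod_decode z = (a, b)"
      by force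
    then have "z = prod_encode (a, b)"
      by (metis prod_decode_inverse)
    then have "root z = a + b" "z = triangle (a + b) + a"
      by (simp_all only: root) (simp add: prod_encode_def)
    with z show "fst (prod_decode z) = z - triangle (root z)"
      "snd (prod_decode z) = root z - fst (prod_decode z)"
      by simp_all
  qed
  show fst': "rcomp X 1 (\<lambda>xs. fst (prod_decode (xs ! 0)))"
    unfolding decode(1) by (intro rcomp_intros r) simp_all
  show "rcomp X 1 (\<lambda>xs. snd (prod_decode (xs ! 0)))"
    unfolding decode(2) by (intro rcomp_intros r fst') simp_all
qed

lemmas rcomp_fst [rcomp_intros] = rcomp_compose1[where h = "\<lambda>z. fst (prod_decode z)", OF rcomp_prod_decode(1)]
lemmas rcomp_snd [rcomp_intros] = rcomp_compose1[where h = "\<lambda>z. snd (prod_decode z)", OF rcomp_prod_decode(2)]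


section \<open>Bits of numbers and coded finite sets\<close>

lemma rcomp_mod_2 [rcomp_intros]:
  assumes "rcomp X n F"
  shows "rcomp X n (\<lambda>xs. F xs mod 2)"
proof (rule rcomp_compose1[where h = "\<lambda>z. z mod 2", OF _ assms])
  show "rcomp X 1 (\<lambda>xs. xs ! 0 mod 2)"
  proof (rule rcomp_prim_rec1[where h = "\<lambda>z. z mod 2" and g = "\<lambda>j y. 1 - y"])
    show "rcomp X 2 (\<lambda>ys. 1 - ys ! 1)"
      by (intro rcomp_intros) simp
  qed presburger
qed

lemma rcomp_div_2 [rcomp_intros]:
  assumes "rcomp X n F"
  shows "rcomp X n (\<lambda>xs. F xs div 2)"
proof (rule rcomp_compose1[where h = "\<lambda>z. z div 2", OF _ assms])
  show "rcomp X 1 (\<lambda>xs. xs ! 0 div 2)"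
  proof (rule rcomp_prim_rec1[where h = "\<lambda>z. z div 2" and g = "\<lambda>j y. y + j mod 2"])
    show "rcomp X 2 (\<lambda>ys. ys ! 1 + ys ! 0 mod 2)"
      by (intro rcomp_intros) simp_all
  qed presburger
qed

text \<open>Membership of \<open>e\<close> in the set coded by \<open>d\<close> is bit
  \<open>e\<close> of \<open>d\<close>: halve \<open>e\<close> times, then take the parity.\<close>

lemma rcomp_mem_set_decode [rcomp_intros]:
  assumes "rcomp X n F" "rcomp X n G"
  shows "rcomp X n (\<lambda>xs. if F xs \<in> set_decode (G xs) then 1 else 0)"
proof -
  have "rcomp X 2 (\<lambda>xs. xs ! 1 div 2 ^ (xs ! 0))"
  proof (rule rcomp_prim_rec2[where h = "\<lambda>e d. d div 2 ^ e" and g = "\<lambda>j y b. y div 2"])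
    show "rcomp X 1 (\<lambda>xs. xs ! 0 div 2 ^ 0)"
      by (simp add: rcomp_intros)
    show "rcomp X 3 (\<lambda>ys. ys ! 1 div 2)"
      by (intro rcomp_intros) simp
    show "b div 2 ^ Suc j = b div 2 ^ j div 2" for j b :: nat
      by (simp only: power_Suc2 div_mult2_eq)
  qed
  then have "rcomp X n (\<lambda>xs. (G xs div 2 ^ F xs) mod 2)"
    by (intro rcomp_mod_2) (rule rcomp_compose2[where h = "\<lambda>e d. d div 2 ^ e", OF _ assms])
  then show ?thesis
    by (simp add: set_decode_def mod_2_eq_odd of_bool_def)
qed

section \<open>Operations on codes of lists and atoms\<close>

definition drop_code :: "nat \<Rightarrow> nat \<Rightarrow> nat" where
  "drop_code m z = list_encode (drop m (list_decode z))"

lemma drop_code_0 [simp]: "drop_code 0 z = z"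
  by (simp add: drop_code_def)

lemma drop_code_Suc: "drop_code (Suc m) z = snd (prod_decode (drop_code m z - 1))"
proof -
  \<comment> \<open>The empty list has code 0, whose truncated predecessor is again 0 and decodes to
    \<open>(0, 0)\<close>; so the formula gives the right tail for the empty list too.\<close>
  have "prod_decode 0 = (0, 0)"
    using prod_encode_inverse[of "(0, 0)"] by (simp add: prod_encode_def)
  then have "list_encode (tl xs) = snd (prod_decode (list_encode xs - 1))" for xs
    by (cases xs) simp_all
  then show ?thesis
    by (metis drop_code_def drop_Suc tl_drop)
qed

lemma rcomp_drop_code [rcomp_intros]:
  assumes "rcomp X n F" "rcomp X n G"
  shows "rcomp X n (\<lambda>xs. drop_code (F xs) (G xs))"
proof (rule rcomp_compose2[OF _ assms])
  show "rcomp X 2 (\<lambda>xs. drop_code (xs ! 0) (xs ! 1))"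
  proof (rule rcomp_prim_rec2[where g = "\<lambda>j y b. snd (prod_decode (y - 1))"])
    show "rcomp X 1 (\<lambda>xs. drop_code 0 (xs ! 0))"
      by (simp add: rcomp_intros)
    show "rcomp X 3 (\<lambda>ys. snd (prod_decode (ys ! 1 - 1)))"
      by (intro rcomp_intros) simp
  qed (rule drop_code_Suc)
qed

text \<open>A number read as a total function: the entries of the coded list, and 0 beyond its end.
  Values on an initial segment can be prescribed at will, so a search over numbers covers all finite
  partial maps.\<close>

definition lookup :: "nat \<Rightarrow> nat \<Rightarrow> nat" where
  "lookup w x = fst (prod_decode (drop_code x w - 1))"

lemma lookup_list_encode: "x < length ys \<Longrightarrow> lookup (list_encode ys) x = ys ! x"
  by (cases "drop x ys") (simp_all add: lookup_def drop_code_def hd_drop_conv_nth[symmetric])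

lemma ex_lookup: "\<exists>w. \<forall>x<N. lookup w x = g x"
  by (rule exI[of _ "list_encode (map g [0..<N])"]) (simp add: lookup_list_encode)

lemma rcomp_lookup [rcomp_intros]:
  assumes "rcomp X n F" "rcomp X n G"
  shows "rcomp X n (\<lambda>xs. lookup (F xs) (G xs))"
  unfolding lookup_def by (intro rcomp_intros assms)

definition map_code :: "nat \<Rightarrow> nat \<Rightarrow> nat" where
  "map_code w z = list_encode (map (lookup w) (list_decode z))"

lemma length_le_list_encode: "length xs \<le> list_encode xs"
proof (induction xs)
  case (Cons x xs)
  then show ?case
    using le_prod_encode_2[of "list_encode xs" x] by simp
qed simp

lemma mem_le_list_encode: "x \<in> set xs \<Longrightarrow> x \<le> list_encode xs"
proof (induction xs)
  case (Cons y ys)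
  then show ?case
    using le_prod_encode_2[of "list_encode ys" y] le_prod_encode_1[of y "list_encode ys"] by auto
qed simp

text \<open>Recursion on \<open>j\<close> traverses the coded list from its end; since a code bounds the length of its
  list, \<open>j = z\<close> yields the whole list.\<close>

primrec map_code_aux :: "nat \<Rightarrow> nat \<Rightarrow> nat \<Rightarrow> nat" where
  "map_code_aux 0 z w = 0"
| "map_code_aux (Suc j) z w =
    (if drop_code (z - Suc j) z = 0 then 0
     else Suc (prod_encode (lookup w (lookup z (z - Suc j)), map_code_aux j z w)))"

lemma map_code_aux:
  "j \<le> z \<Longrightarrow> map_code_aux j z w = list_encode (map (lookup w) (drop (z - j) (list_decode z)))"
proof (induction j)
  case 0
  then show ?case
    using length_le_list_encode[of "list_decode z"] by simp
next
  case (Suc j)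
  have ys: "lookup z i = list_decode z ! i" if "i < length (list_decode z)" for i
    using lookup_list_encode[OF that] by simp
  show ?case
  proof (cases "z - Suc j < length (list_decode z)")
    case True
    then have d: "drop (z - Suc j) (list_decode z) =
        list_decode z ! (z - Suc j) # drop (z - j) (list_decode z)"
      using Suc.prems by (metis Cons_nth_drop_Suc Suc_diff_Suc Suc_le_lessD)
    then have "drop_code (z - Suc j) z \<noteq> 0"
      by (simp add: drop_code_def)
    then show ?thesis
      using Suc True by (simp add: d ys)
  next
    case False
    then show ?thesis
      by (simp add: drop_code_def)
  qed
qed

lemma rcomp_map_code [rcomp_intros]:
  assumes "rcomp X n F" "rcomp X n G"
  shows "rcomp X n (\<lambda>xs. map_code (F xs) (G xs))"
proof -
  have "rcomp X 3 (\<lambda>xs. map_code_aux (xs ! 0) (xs ! 1) (xs ! 2))"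
  proof (rule rcomp_prim_rec3[where g = "\<lambda>j y z w. if drop_code (z - Suc j) z = 0 then 0
     else Suc (prod_encode (lookup w (lookup z (z - Suc j)), y))"])
    show "rcomp X 4 (\<lambda>ys. if drop_code (ys ! 2 - Suc (ys ! 0)) (ys ! 2) = 0 then 0
        else Suc (prod_encode (lookup (ys ! 3) (lookup (ys ! 2) (ys ! 2 - Suc (ys ! 0))), ys ! 1)))"
      by (intro rcomp_intros) simp_all
  qed (simp_all add: rcomp_intros)
  from rcomp_compose3[OF this assms(2,2,1)] show ?thesis
    by (simp add: map_code_aux map_code_def)
qed

section \<open>Images of atoms under coded maps\<close>

fun atom_map :: "(nat \<Rightarrow> nat) \<Rightarrow> atom \<Rightarrow> atom" where
  "atom_map f (EqAtom a b) = EqAtom (f a) (f b)"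
| "atom_map f (RelAtom i xs) = RelAtom i (map f xs)"

text \<open>\<open>sum_encode\<close> gives equality atoms even codes and relational atoms odd ones,
  so the parity of \<open>e\<close> tells the kind and \<open>e div 2\<close> is the coded
  content.\<close>

definition atom_map_code :: "nat \<Rightarrow> nat \<Rightarrow> nat" where
  "atom_map_code w e = (if e mod 2 = 0
     then 2 * prod_encode (lookup w (fst (prod_decode (e div 2))), lookup w (snd (prod_decode (e div 2))))
     else Suc (2 * prod_encode (fst (prod_decode (e div 2)), map_code w (snd (prod_decode (e div 2))))))"

lemma atom_map_code: "atom_map_code w (atom_code a) = atom_code (atom_map (lookup w) a)"
  by (cases a) (simp_all add: atom_map_code_def sum_encode_def map_code_def)

lemma rcomp_atom_map_code [rcomp_intros]:
  assumes "rcomp X n F" "rcomp X n G"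
  shows "rcomp X n (\<lambda>xs. atom_map_code (F xs) (G xs))"
  unfolding atom_map_code_def using assms
  by (intro rcomp_if_zero rcomp_mult rcomp_prod_encode rcomp_Suc rcomp_const rcomp_lookup rcomp_fst
      rcomp_snd rcomp_map_code rcomp_mod_2 rcomp_div_2)

lemma inj_atom_code: "inj atom_code"
proof (rule injI)
  fix a b assume "atom_code a = atom_code b"
  then show "a = b"
    by (cases a; cases b) (simp_all add: sum_encode_eq list_encode_eq)
qed

lemma ex_atom_code: "\<exists>a. atom_code a = e"
proof (cases "sum_decode e")
  case (Inl z)
  then have "atom_code (EqAtom (fst (prod_decode z)) (snd (prod_decode z))) = e"
    by (metis atom_code.simps(1) prod.collapse prod_decode_inverse sum_decode_inverse)
  then show ?thesis ..
next
  case (Inr z)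
  then have "atom_code (RelAtom (fst (prod_decode z)) (list_decode (snd (prod_decode z)))) = e"
    by (metis atom_code.simps(2) list_decode_inverse prod.collapse prod_decode_inverse sum_decode_inverse)
  then show ?thesis ..
qed

text \<open>Here \<open>w\<close> codes the embedding, \<open>c\<close> the tuple in the observed structure with code \<open>d\<close>, and \<open>a\<close>
  the locking tuple of \<open>A\<close>. Only atoms with code \<open>e\<close> such that \<open>e\<close> lies in the observed domain are
  compared: the restriction already decides these correctly, and every atom is reached in the limit.\<close>

definition mismatch :: "struct \<Rightarrow> nat \<Rightarrow> nat \<Rightarrow> nat \<Rightarrow> nat \<Rightarrow> nat \<Rightarrow> nat" where
  "mismatch A a m w c d =
     (\<Sum>l<m. if lookup w (lookup c l) = lookup a l then 0 else 1) +
     (\<Sum>e<d. if (if atom_code (EqAtom e e) \<in> set_decode d then 1 else 0) = (0 :: nat) then 0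
        else if (if e \<in> set_decode d then 1 else 0) =
             (if atom_map_code w e \<in> atom_code ` diagram A then 1 else (0 :: nat)) then 0 else 1)"

text \<open>The decision procedure for the diagram and the numbers \<open>a\<close> and
  \<open>m\<close> are built into the program. It runs without an oracle, since
  \<open>halting_set\<close> decides searches by oracle-free programs only.\<close>

lemma rcomp_mismatch:
  assumes "computable_struct A"
  shows "rcomp {} 3 (\<lambda>xs. mismatch A a m (xs ! 0) (xs ! 1) (xs ! 2))"
proof -
  \<comment> \<open>Position 0 holds the summation index; \<open>w\<close>, \<open>c\<close> and
    \<open>d\<close> move to positions 1 to 3. In \<open>?G\<close>, the number
    \<open>2 * prod_encode (ys ! 0, ys ! 0)\<close> is the code of an equality atom.\<close>
  let ?F = "\<lambda>ys. if lookup (ys ! 1) (lookup (ys ! 2) (ys ! 0)) = lookup a (ys ! 0) then 0 else 1"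
  let ?chi = "\<lambda>x. if x \<in> atom_code ` diagram A then 1 else 0 :: nat"
  let ?G = "\<lambda>ys. if (if 2 * prod_encode (ys ! 0, ys ! 0) \<in> set_decode (ys ! 3) then 1 else 0) = (0 :: nat) then 0
        else if (if ys ! 0 \<in> set_decode (ys ! 3) then 1 else 0) =
             ?chi (atom_map_code (ys ! 1) (ys ! 0)) then 0 else 1"
  obtain p where "run {} p [x] (?chi x)" for x
    using assms unfolding computable_struct_def computable_set_def computable_fun_def by blast
  then have chi: "rcomp {} 1 (\<lambda>xs. ?chi (xs ! 0))"
    by (rule rcomp_1I)
  have "rcomp {} (Suc 3) ?F"
    by (intro rcomp_intros) simp_all
  moreover have "rcomp {} 4 (\<lambda>ys. ?chi (atom_map_code (ys ! 1) (ys ! 0)))"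
    by (rule rcomp_compose1[where h = ?chi, OF chi]) (intro rcomp_atom_map_code rcomp_nth; simp)
  then have "rcomp {} (Suc 3) ?G"
    by (intro rcomp_if_zero rcomp_if_eq rcomp_mem_set_decode rcomp_const rcomp_mult rcomp_prod_encode
        rcomp_nth) simp_all
  ultimately have "rcomp {} 3 (\<lambda>xs. (\<Sum>e<m. ?F (e # xs)) + (\<Sum>e<xs ! 2. ?G (e # xs)))"
    by (intro rcomp_add rcomp_sum rcomp_const rcomp_nth) simp_all
  then show ?thesis
    by (simp add: mismatch_def sum_encode_def nth_Cons' cong: if_cong)
qed

text \<open>Each of the finitely many indices may have an unrelated program; equality tests on the
  index select among them. The default 1, being nonzero, makes a search for zeros fail at an index
  out of range.\<close>

lemma rcomp_cases:
  assumes "\<And>i. i < r \<Longrightarrow> rcomp X n (F i)" "rcomp X n I"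
  shows "rcomp X n (\<lambda>xs. if I xs < r then F (I xs) xs else 1)"
  using assms(1)
proof (induction r)
  case 0
  show ?case
    by (simp add: rcomp_const)
next
  case (Suc r)
  have "rcomp X n (\<lambda>xs. if I xs = r then F r xs else if I xs < r then F (I xs) xs else 1)"
    using Suc by (intro rcomp_if_eq rcomp_const assms(2)) simp_all
  also have "(\<lambda>xs. if I xs = r then F r xs else if I xs < r then F (I xs) xs else 1) =
      (\<lambda>xs. if I xs < Suc r then F (I xs) xs else 1)"
    by (auto simp: less_Suc_eq)
  finally show ?case .
qed

section \<open>Searches relative to the halting set\<close>

text \<open>Injectivity lets membership of a code in \<open>halting_set\<close> speak about one
  particular program.\<close>

lemma recf_code_eq_iff: "recf_code p = recf_code q \<longleftrightarrow> p = q"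
proof (induction p arbitrary: q)
  case (Comp p qs)
  have "map recf_code qs = map recf_code qs' \<longleftrightarrow> qs = qs'" for qs'
    using Comp.IH(2) by (metis list.inj_map_strong)
  then show ?case
    by (cases q) (simp_all add: Comp.IH(1) list_encode_eq)
qed (case_tac q; simp)+

lemma mem_halting_set_iff: "prod_encode (recf_code p, x) \<in> halting_set \<longleftrightarrow> (\<exists>y. run {} p [x] y)"
  by (auto simp: halting_set_def recf_code_eq_iff)

text \<open>As \<open>R\<close> is total, the search \<open>Mu p\<close> halts on \<open>x\<close>
  exactly if a zero exists. Its code is a constant, so the oracle is asked at the pair of that code
  and \<open>F xs\<close>.\<close>

lemma rcomp_exists_zero:
  assumes "rcomp {} 2 (\<lambda>xs. R (xs ! 0) (xs ! 1))" "rcomp halting_set n F"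
  shows "rcomp halting_set n (\<lambda>xs. if \<exists>w. R w (F xs) = 0 then 1 else 0)"
proof -
  obtain p where p: "\<And>xs. length xs = 2 \<Longrightarrow> run {} p xs (R (xs ! 0) (xs ! 1))"
    using assms(1) by (rule rcompE) blast
  have "run {} p (w # [x]) (R w x)" for w x
    using p[of "[w, x]"] by simp
  then have mu: "run {} (Mu p) [x] y \<longleftrightarrow> R y x = 0 \<and> (\<forall>m<y. R m x \<noteq> 0)" for x y
    by (rule run_Mu_total)
  have "(\<exists>y. run {} (Mu p) [x] y) \<longleftrightarrow> (\<exists>w. R w x = 0)" for x
    unfolding mu using exists_least_iff[of "\<lambda>w. R w x = 0"] by blast
  then have "prod_encode (recf_code (Mu p), x) \<in> halting_set \<longleftrightarrow> (\<exists>w. R w x = 0)" for x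
    by (simp only: mem_halting_set_iff)
  moreover have "rcomp halting_set 1 (\<lambda>xs. if xs ! 0 \<in> halting_set then 1 else 0)"
    by (rule rcomp_1I[OF run_Query])
  then have "rcomp halting_set n
      (\<lambda>xs. if prod_encode (recf_code (Mu p), F xs) \<in> halting_set then 1 else 0)"
    by (rule rcomp_compose1[where h = "\<lambda>z. if z \<in> halting_set then 1 else 0"])
       (intro rcomp_prod_encode rcomp_const assms(2))
  ultimately show ?thesis
    by (simp only:)
qed

text \<open>The search diverges on an \<open>x\<close> for which no \<open>k\<close> qualifies, so
  the program computes a partial function, which \<open>rcomp\<close> does not describe.\<close>

lemma ex_run_Least:
  assumes "rcomp X 2 (\<lambda>xs. if Q (xs ! 0) (xs ! 1) then 1 else 0)" "rcomp X 1 (\<lambda>xs. h (xs ! 0))"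
  shows "\<exists>p. \<forall>x. (\<exists>k. Q k x) \<longrightarrow> run X p [x] (h (LEAST k. Q k x))"
proof -
  have "rcomp X 2 (\<lambda>xs. 1 - (if Q (xs ! 0) (xs ! 1) then 1 else 0))"
    by (intro rcomp_diff rcomp_const assms(1))
  then obtain p where p: "\<And>xs. length xs = 2 \<Longrightarrow> run X p xs (1 - (if Q (xs ! 0) (xs ! 1) then 1 else 0))"
    by (rule rcompE) blast
  obtain q where q: "\<And>xs. length xs = 1 \<Longrightarrow> run X q xs (h (xs ! 0))"
    using assms(2) by (rule rcompE) blast
  have "run X (Comp q [Mu p]) [x] (h (LEAST k. Q k x))" if "\<exists>k. Q k x" for x
  proof (rule run_Comp)
    have "run X p (k # [x]) (1 - (if Q k x then 1 else 0))" for k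
      using p[of "[k, x]"] by simp
    moreover have "\<exists>k. 1 - (if Q k x then 1 else 0) = (0 :: nat)"
      using that by auto
    ultimately have "run X (Mu p) [x] (LEAST k. 1 - (if Q k x then 1 else 0) = (0 :: nat))"
      by (rule run_Mu_Least[where F = "\<lambda>k. 1 - (if Q k x then 1 else 0)"])
    moreover have "(LEAST k. 1 - (if Q k x then 1 else 0) = (0 :: nat)) = (LEAST k. Q k x)"
      by (rule arg_cong[where f = Least]) auto
    ultimately have "run X (Mu p) [x] (LEAST k. Q k x)"
      by simp
    then show "list_all2 (\<lambda>q. run X q [x]) [Mu p] [LEAST k. Q k x]"
      by simp
    show "run X q [LEAST k. Q k x] (h (LEAST k. Q k x))"
      using q[of "[LEAST k. Q k x]"] by simp
  qed
  then show ?thesis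
    by blast
qed


section \<open>Copies of structures and locking conditions\<close>

text \<open>With \<open>h\<close> bijective these are exactly the copies of \<open>A\<close>. An
  isomorphism becomes an equation between structures, and a copy is varied by varying
  \<open>h\<close>.\<close>

definition pull :: "(nat \<Rightarrow> nat) \<Rightarrow> struct \<Rightarrow> struct" where
  "pull h A = (\<lambda>i. {xs. map h xs \<in> A i})"

lemma isomorphic_iff_pull: "S \<cong> A \<longleftrightarrow> (\<exists>f. bij f \<and> S = pull f A)"
  by (auto simp: isomorphic_def pull_def fun_eq_iff set_eq_iff)

lemma pull_pull: "pull g (pull h A) = pull (h \<circ> g) A"
  by (simp add: pull_def)

lemma isomorphic_sym: "A \<cong> B \<Longrightarrow> B \<cong> A"
proof -
  assume "A \<cong> B"
  then obtain f where f: "bij f" "A = pull f B"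
    unfolding isomorphic_iff_pull by blast
  then have "B = pull (inv f) A"
    by (simp add: pull_pull surj_iff[THEN iffD1, OF bij_is_surj]) (simp add: pull_def)
  with f(1) show "B \<cong> A"
    unfolding isomorphic_iff_pull by (blast intro: bij_imp_bij_inv)
qed

lemma isomorphic_trans: "A \<cong> B \<Longrightarrow> B \<cong> C \<Longrightarrow> A \<cong> C"
  unfolding isomorphic_iff_pull using pull_pull bij_comp by metis

lemma is_struct_pull: "is_struct L A \<Longrightarrow> is_struct L (pull h A)"
  unfolding is_struct_def pull_def by fastforce

lemma is_struct_isomorphic: "S \<cong> A \<Longrightarrow> is_struct L A \<Longrightarrow> is_struct L S"
  unfolding isomorphic_iff_pull using is_struct_pull by blast

lemma restr_eqI:
  assumes "\<And>i xs. i \<in> visible L n \<Longrightarrow> set xs \<subseteq> {..n} \<Longrightarrow> xs \<in> S i \<longleftrightarrow> xs \<in> T i"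
  shows "restr L S n = restr L T n"
  unfolding restr_def using assms by auto

lemma restr_pull_cong:
  assumes "\<And>x. x \<le> n \<Longrightarrow> f x = g x"
  shows "restr L (pull f A) n = restr L (pull g A) n"
proof (rule restr_eqI)
  fix i xs assume "set xs \<subseteq> {..n}"
  then have "map f xs = map g xs"
    using assms by auto
  then show "xs \<in> pull f A i \<longleftrightarrow> xs \<in> pull g A i"
    by (simp only: pull_def mem_Collect_eq)
qed

text \<open>The set \<open>F\<close> and its image have equal size, so the parts of their union
  outside each are equinumerous and can be matched; outside the union the identity serves.\<close>

lemma extend_inj_on_to_bij:
  fixes f :: "'a \<Rightarrow> 'a"
  assumes "finite F" "inj_on f F"
  obtains h where "bij h" "\<And>x. x \<in> F \<Longrightarrow> h x = f x"
proof -
  let ?U = "F \<union> f ` F"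
  have "card (?U - F) = card (?U - f ` F)"
    using assms by (simp add: card_Diff_subset card_image)
  then obtain k where k: "bij_betw k (?U - F) (?U - f ` F)"
    using assms(1) by (metis finite_Diff finite_UnI finite_imageI finite_same_card_bij)
  define h where "h x = (if x \<in> F then f x else if x \<in> ?U then k x else x)" for x
  have "bij_betw h F (f ` F)"
    using assms(2) by (auto simp: h_def bij_betw_def inj_on_def)
  moreover have "bij_betw h (?U - F) (?U - f ` F)"
    using k by (subst bij_betw_cong[of _ _ k]) (auto simp: h_def)
  ultimately have "bij_betw h (F \<union> (?U - F)) (f ` F \<union> (?U - f ` F))"
    by (rule bij_betw_combine) auto
  then have "bij_betw h ?U ?U"
    by (simp add: Un_absorb1 sup.absorb2 Un_commute)
  moreover have "bij_betw h (- ?U) (- ?U)"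
    by (subst bij_betw_cong[of _ _ id]) (auto simp: h_def)
  ultimately have "bij_betw h (?U \<union> - ?U) (?U \<union> - ?U)"
    by (rule bij_betw_combine) auto
  then have "bij h"
    by (simp only: Compl_partition)
  then show ?thesis
    by (rule that) (simp add: h_def)
qed

text \<open>The structures \<open>pull h A\<close> are the copies of \<open>A\<close> whose first
  \<open>m\<close> elements play the roles of the first \<open>m\<close> values of \<open>g\<close>;
  \<open>m \<le> n\<close> keeps these elements inside the restriction.\<close>

definition locking ::
  "rel_signature \<Rightarrow> (atom set \<Rightarrow> struct option) \<Rightarrow> struct \<Rightarrow> (nat \<Rightarrow> nat) \<Rightarrow> nat \<Rightarrow> bool" where
  "locking L M A g m \<longleftrightarrow>
     (\<forall>h n. bij h \<longrightarrow> (\<forall>x<m. h x = g x) \<longrightarrow> m \<le> n \<longrightarrow> M (restr L (pull h A) n) = Some A)"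

text \<open>The conditions of the forcing construction are bijections with a finite part declared fixed,
  so that every condition is itself a copy of \<open>A\<close>; stage \<open>s\<close> puts \<open>s\<close> into the range.\<close>

lemma ex_locking:
  assumes lim: "\<And>S. S \<cong> A \<Longrightarrow> \<forall>\<^sub>F n in sequentially. M (restr L S n) = Some A"
  shows "\<exists>g m. bij g \<and> locking L M A g m"
proof (rule ccontr)
  assume no_lock: "\<not> ?thesis"
  define P where "P = (\<lambda>(s :: nat) (gm :: (nat \<Rightarrow> nat) \<times> nat). bij (fst gm))"
  \<comment> \<open>The stage \<open>n\<close> of the wrong conjecture lies below the new bound
    \<open>snd hm\<close>, so later changes of the bijection cannot repair it.\<close>
  define Q where "Q = (\<lambda>s gm hm. (\<forall>x < snd gm. fst hm x = fst gm x) \<and> snd gm < snd hm \<and>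
    s \<in> fst hm ` {..<snd hm} \<and>
    (\<exists>n\<ge>snd gm. n < snd hm \<and> M (restr L (pull (fst hm) A) n) \<noteq> Some A))"
  have "\<exists>f. \<forall>s. P s (f s) \<and> Q s (f s) (f (Suc s))"
  proof (rule dependent_nat_choice)
    show "\<exists>gm. P 0 gm"
      unfolding P_def by (rule exI[of _ "(id, 0)"]) simp
  next
    fix gm s assume "P s gm"
    then obtain h n where h: "bij h" "\<forall>x < snd gm. h x = fst gm x" "snd gm \<le> n"
      "M (restr L (pull h A) n) \<noteq> Some A"
      using no_lock unfolding locking_def P_def by blast
    \<comment> \<open>The new bound exceeds \<open>n\<close>, freezing the wrong conjecture, and
      \<open>inv h s\<close>, putting \<open>s\<close> into the range of the fixed part.\<close>
    have "s \<in> h ` {..<Suc (max n (inv h s))}"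
      using h(1) by (intro image_eqI[of _ _ "inv h s"]) (auto simp: bij_is_surj surj_f_inv_f)
    then show "\<exists>hm. P (Suc s) hm \<and> Q s gm hm"
      unfolding P_def Q_def using h by (intro exI[of _ "(h, Suc (max n (inv h s)))"]) auto
  qed
  then obtain f where f: "\<And>s. P s (f s)" "\<And>s. Q s (f s) (f (Suc s))"
    by blast
  define g where "g s = fst (f s)" for s
  define m where "m s = snd (f s)" for s
  have bij: "bij (g s)" for s
    using f(1) by (simp add: P_def g_def)
  have step: "x < m s \<Longrightarrow> g (Suc s) x = g s x" "m s < m (Suc s)" "s \<in> g (Suc s) ` {..<m (Suc s)}"
    "\<exists>n\<ge>m s. n < m (Suc s) \<and> M (restr L (pull (g (Suc s)) A) n) \<noteq> Some A" for s x
    using f(2)[of s] by (simp_all add: Q_def g_def m_def)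
  have "strict_mono m"
    using step(2) by (simp add: strict_mono_Suc_iff)
  then have m_ge: "s \<le> m s" and m_mono: "s \<le> t \<Longrightarrow> m s \<le> m t" for s t
    by (simp_all add: strict_mono_imp_increasing strict_mono_less_eq)
  have stable: "g t x = g s x" if "s \<le> t" "x < m s" for s t x
    using that(1)
  proof (induction t rule: dec_induct)
    case (step t)
    have "x < m t"
      using that(2) m_mono[OF step(1)] by simp
    then show ?case
      using step \<open>\<And>s x. x < m s \<Longrightarrow> g (Suc s) x = g s x\<close> by simp
  qed simp
  \<comment> \<open>Since \<open>s \<le> m s\<close>, the argument \<open>x\<close> is below
    \<open>m (Suc x)\<close>, so its value no longer changes after stage
    \<open>Suc x\<close>.\<close>
  define G where "G x = g (Suc x) x" for x
  have G: "G x = g s x" if "x < m s" for s x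
    unfolding G_def using stable[of s "Suc x" x] stable[of "Suc x" s x] that m_ge[of "Suc x"]
    by (cases "s \<le> Suc x") simp_all
  have "inj G"
  proof (rule injI)
    fix x y assume "G x = G y"
    moreover have "x < m (Suc (max x y))" "y < m (Suc (max x y))"
      using m_ge[of "Suc (max x y)"] by simp_all
    ultimately show "x = y"
      using bij[of "Suc (max x y)"] by (simp add: G bij_def inj_eq)
  qed
  moreover have "surj G"
    unfolding surj_def
  proof
    show "\<exists>x. s = G x" for s
      using step(3)[of s] G by fastforce
  qed
  ultimately have "pull G A \<cong> A"
    unfolding isomorphic_iff_pull by (blast intro: bijI)
  from lim[OF this] obtain N where N: "\<And>n. n \<ge> N \<Longrightarrow> M (restr L (pull G A) n) = Some A"
    unfolding eventually_sequentially by blast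
  obtain n where n: "m N \<le> n" "n < m (Suc N)" "M (restr L (pull (g (Suc N)) A) n) \<noteq> Some A"
    using step(4) by blast
  have "restr L (pull G A) n = restr L (pull (g (Suc N)) A) n"
    using n(2) by (intro restr_pull_cong G) simp
  then show False
    using N[of n] n m_ge[of N] by simp
qed

section \<open>Comparison of finite parts\<close>

text \<open>Bounding the codes of atoms gives a condition that weakens as \<open>n\<close> falls and
  whose part about \<open>S\<close> can be read off \<open>restr L S n\<close>. Through the equality
  atoms it also forces injectivity.\<close>

definition agree :: "struct \<Rightarrow> struct \<Rightarrow> (nat \<Rightarrow> nat) \<Rightarrow> nat \<Rightarrow> bool" where
  "agree A S f n \<longleftrightarrow>
     (\<forall>a. atom_code a \<le> n \<longrightarrow> (a \<in> diagram S \<longleftrightarrow> atom_map f a \<in> diagram A))"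

lemma agree_antimono: "n \<le> n' \<Longrightarrow> agree A S f n' \<Longrightarrow> agree A S f n"
  unfolding agree_def using order_trans by blast

lemma eq_in_diagram_iff [simp]: "EqAtom a b \<in> diagram A \<longleftrightarrow> a = b"
  by (auto simp: diagram_def)

lemma rel_in_diagram_iff [simp]: "RelAtom i xs \<in> diagram A \<longleftrightarrow> xs \<in> A i"
  by (auto simp: diagram_def)

fun atom_elems :: "atom \<Rightarrow> nat set" where
  "atom_elems (EqAtom a b) = {a, b}"
| "atom_elems (RelAtom i xs) = set xs"

lemma atom_map_cong: "(\<And>x. x \<in> atom_elems a \<Longrightarrow> f x = g x) \<Longrightarrow> atom_map f a = atom_map g a"
  by (cases a) simp_all

lemma symbol_le_atom_code: "i \<le> atom_code (RelAtom i xs)"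
  using le_prod_encode_1[of i "list_encode xs"] by (simp add: sum_encode_def)

lemma atom_elem_le_atom_code: "x \<in> atom_elems a \<Longrightarrow> x \<le> atom_code a"
proof (cases a)
  case (EqAtom b c)
  then show "x \<in> atom_elems a \<Longrightarrow> x \<le> atom_code a"
    using le_prod_encode_1[of b c] le_prod_encode_2[of c b] by (auto simp: sum_encode_def)
next
  case (RelAtom i xs)
  then show "x \<in> atom_elems a \<Longrightarrow> x \<le> atom_code a"
    using mem_le_list_encode[of x xs] le_prod_encode_2[of "list_encode xs" i]
    by (auto simp: sum_encode_def)
qed

text \<open>The code of an atom bounds its symbol and its elements, so neither the cut of the domain
  nor that of an infinite signature removes it.\<close>

lemma mem_restr_iff:
  assumes "is_struct L S" "atom_code a \<le> n"
  shows "a \<in> restr L S n \<longleftrightarrow> a \<in> diagram S"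
proof (cases a)
  case (EqAtom b c)
  then show ?thesis
    using assms(2) atom_elem_le_atom_code[of b a] by (auto simp: restr_def)
next
  case (RelAtom i xs)
  have "i \<le> n" "set xs \<subseteq> {..n}"
    using assms(2) symbol_le_atom_code[of i xs] atom_elem_le_atom_code[of _ a] RelAtom by force+
  moreover have "i \<in> dom L" if "xs \<in> S i"
    using assms(1) that unfolding is_struct_def by blast
  ultimately show ?thesis
    using RelAtom by (auto simp: restr_def visible_def)
qed

lemma set_decode_finite_struct_code:
  "is_struct L S \<Longrightarrow> set_decode (finite_struct_code (restr L S n)) = atom_code ` restr L S n"
  by (simp add: finite_struct_code_def finite_restr)

lemma less_if_mem_set_decode: "e \<in> set_decode d \<Longrightarrow> e < d"
proof -
  assume "e \<in> set_decode d"
  then have "d div 2 ^ e \<noteq> 0"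
    unfolding set_decode_def by (metis even_zero mem_Collect_eq)
  then have "2 ^ e \<le> d"
    by (metis div_less linorder_not_le)
  then show "e < d"
    by (rule order.strict_trans2[OF less_exp])
qed

lemma mismatch_eq_0_iff:
  assumes "is_struct L S"
  shows "mismatch A a m w c (finite_struct_code (restr L S n)) = 0 \<longleftrightarrow>
    (\<forall>l<m. lookup w (lookup c l) = lookup a l) \<and> agree A S (lookup w) n"
proof -
  define d where "d = finite_struct_code (restr L S n)"
  have code_mem: "atom_code b \<in> atom_code ` X \<longleftrightarrow> b \<in> X" for b X
    using inj_image_mem_iff[OF inj_atom_code] .
  have dec: "atom_code b \<in> set_decode d \<longleftrightarrow> b \<in> restr L S n" for b
    unfolding d_def set_decode_finite_struct_code[OF assms] by (rule code_mem)
  have eq: "atom_code (EqAtom e e) \<in> set_decode d \<longleftrightarrow> e \<le> n" for e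
    unfolding dec by (auto simp: restr_def)
  \<comment> \<open>\<open>e\<close> is at most the code of \<open>EqAtom e e\<close>, which lies in
    the set coded by \<open>d\<close> and hence is less than \<open>d\<close>. So the sum over
    \<open>e < d\<close> in \<open>mismatch\<close> reaches every \<open>e \<le> n\<close>.\<close>
  have less: "e < d" if "e \<le> n" for e
    using that less_if_mem_set_decode[of "atom_code (EqAtom e e)" d] eq
      atom_elem_le_atom_code[of e "EqAtom e e"] by fastforce
  have "mismatch A a m w c d = 0 \<longleftrightarrow> (\<forall>l<m. lookup w (lookup c l) = lookup a l) \<and>
    (\<forall>e<d. e \<le> n \<longrightarrow> (e \<in> set_decode d \<longleftrightarrow> atom_map_code w e \<in> atom_code ` diagram A))"
    unfolding mismatch_def eq by (auto split: if_splits)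
  also have "(\<forall>e<d. e \<le> n \<longrightarrow> (e \<in> set_decode d \<longleftrightarrow> atom_map_code w e \<in> atom_code ` diagram A)) \<longleftrightarrow>
      (\<forall>b. atom_code b \<le> n \<longrightarrow> (atom_code b \<in> set_decode d \<longleftrightarrow>
        atom_map_code w (atom_code b) \<in> atom_code ` diagram A))"
    using less ex_atom_code by metis
  also have "\<dots> \<longleftrightarrow> agree A S (lookup w) n"
    unfolding agree_def dec atom_map_code code_mem using mem_restr_iff[OF assms] by blast
  finally show ?thesis
    by (simp add: d_def)
qed

section \<open>Surviving candidates and the isomorphism type\<close>

lemma agree_pull:
  assumes "inj f" "\<And>x. x \<le> n \<Longrightarrow> h x = f x"
  shows "agree A (pull f A) h n"
  unfolding agree_def
proof (intro allI impI)
  fix a assume "atom_code a \<le> n"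
  then have "atom_map h a = atom_map f a"
    using assms(2) atom_elem_le_atom_code by (intro atom_map_cong) (meson order_trans)
  moreover have "a \<in> diagram (pull f A) \<longleftrightarrow> atom_map f a \<in> diagram A"
    using assms(1) by (cases a) (simp_all add: pull_def inj_eq)
  ultimately show "a \<in> diagram (pull f A) \<longleftrightarrow> atom_map h a \<in> diagram A"
    by simp
qed

text \<open>The copy is \<open>pull \<pi> S\<close> with \<pi> extending \<open>c\<close>. Each of
  its restrictions from \<open>m\<close> on coincides with one of some \<open>pull h A\<close> with
  \<open>h\<close> equal to \<open>g\<close> below \<open>m\<close>, where the lock prescribes the
  conjecture; \<open>h\<close> may change with \<open>n\<close>.\<close>

lemma locking_sound:
  assumes lock: "locking L M A g m" and g: "bij g" and structs: "is_struct L S" "is_struct L A"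
    and emb: "\<And>n. \<exists>f. (\<forall>l<m. f (c l) = g l) \<and> agree A S f n"
  shows "\<exists>T. T \<cong> S \<and> (\<forall>\<^sub>F n in sequentially. M (restr L T n) = Some A)"
proof -
  \<comment> \<open>Some \<open>f\<close> sends \<open>c l\<close> to \<open>g l\<close> for all
    \<open>l < m\<close>, and \<open>g\<close> is injective, so \<open>c\<close> has no repetitions
    there.\<close>
  have "inj_on c {..<m}"
    using emb[of 0] g by (metis bij_pointE inj_onI lessThan_iff)
  then obtain \<pi> where \<pi>: "bij \<pi>" "\<And>l. l < m \<Longrightarrow> \<pi> l = c l"
    using extend_inj_on_to_bij[of "{..<m}" c] by (metis finite_lessThan lessThan_iff)
  have "M (restr L (pull \<pi> S) n) = Some A" if "m \<le> n" for n
  proof -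
    \<comment> \<open>These are all atoms, true or not, on elements up to \<open>n\<close> with
      visible symbols. Being finitely many, their images under \<pi> have codes at most some
      \<open>N\<close>, and agreement up to \<open>N\<close> settles them all.\<close>
    define X where "X = (\<lambda>(x, y). EqAtom x y) ` ({..n} \<times> {..n}) \<union>
      (\<Union>i \<in> visible L n. RelAtom i ` {xs. set xs \<subseteq> {..n} \<and> length xs = the (L i)})"
    have "finite X"
      unfolding X_def
      by (intro finite_UnI finite_UN_I finite_imageI finite_cartesian_product finite_lists_length_eq)
         (simp_all add: visible_def)
    then obtain N where N: "\<And>a. a \<in> X \<Longrightarrow> atom_code (atom_map \<pi> a) \<le> N"
      using finite_nat_set_iff_bounded_le[of "(\<lambda>a. atom_code (atom_map \<pi> a)) ` X"] by auto
    obtain f where f: "\<And>l. l < m \<Longrightarrow> f (c l) = g l" "agree A S f N"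
      using emb by blast
    have agree: "atom_map \<pi> a \<in> diagram S \<longleftrightarrow> atom_map f (atom_map \<pi> a) \<in> diagram A" if "a \<in> X" for a
      using f(2) N[OF that] unfolding agree_def by blast
    have "inj_on (f \<circ> \<pi>) {..n}"
    proof (rule inj_onI)
      fix x y assume "x \<in> {..n}" "y \<in> {..n}" "(f \<circ> \<pi>) x = (f \<circ> \<pi>) y"
      then have "\<pi> x = \<pi> y"
        using agree[of "EqAtom x y"] by (auto simp: X_def)
      then show "x = y"
        using \<pi>(1) by (simp add: bij_def inj_eq)
    qed
    then obtain h where h: "bij h" "\<And>x. x \<le> n \<Longrightarrow> h x = f (\<pi> x)"
      using extend_inj_on_to_bij[of "{..n}" "f \<circ> \<pi>"] by (metis atMost_iff comp_apply finite_atMost)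
    have "restr L (pull h A) n = restr L (pull \<pi> S) n"
    proof (rule restr_eqI)
      fix i xs assume i: "i \<in> visible L n" and xs: "set xs \<subseteq> {..n}"
      have eq: "map h xs = map f (map \<pi> xs)"
        using xs h(2) by auto
      show "xs \<in> pull h A i \<longleftrightarrow> xs \<in> pull \<pi> S i"
      proof (cases "L i = Some (length xs)")
        case True
        then have "RelAtom i xs \<in> RelAtom i ` {xs. set xs \<subseteq> {..n} \<and> length xs = the (L i)}"
          using xs by simp
        then have "RelAtom i xs \<in> X"
          unfolding X_def using i by blast
        from agree[OF this] show ?thesis
          by (simp add: pull_def eq)
      next
        case False
        then show ?thesis
          using is_struct_pull[OF structs(1)] is_struct_pull[OF structs(2)]
          unfolding is_struct_def by blast
      qed
    qed
    moreover have "\<forall>x<m. h x = g x"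
      using h(2) \<pi>(2) f(1) that by simp
    ultimately show ?thesis
      using lock h(1) that unfolding locking_def by metis
  qed
  then have "\<forall>\<^sub>F n in sequentially. M (restr L (pull \<pi> S) n) = Some A"
    unfolding eventually_sequentially by blast
  then show ?thesis
    using \<pi>(1) isomorphic_iff_pull by blast
qed

text \<open>\<open>c\<close> lists the preimages of the first \<open>m\<close> values of
  \<open>g\<close> under an isomorphism, one choice for all \<open>n\<close>; \<open>w\<close> is a
  finite table of the isomorphism and depends on \<open>n\<close>.\<close>

lemma locking_complete:
  assumes "bij g" "S \<cong> A"
  shows "\<exists>c. \<forall>n. \<exists>w. (\<forall>l<m. lookup w (lookup c l) = g l) \<and> agree A S (lookup w) n"
proof -
  obtain f where f: "bij f" "S = pull f A"
    using assms(2) isomorphic_iff_pull by blast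
  obtain c where c: "\<And>l. l < m \<Longrightarrow> lookup c l = inv f (g l)"
    using ex_lookup[of m "\<lambda>l. inv f (g l)"] by blast
  obtain b where b: "\<And>l. l < m \<Longrightarrow> lookup c l \<le> b"
    using finite_nat_set_iff_bounded_le[of "lookup c ` {..<m}"] by auto
  have "\<exists>w. (\<forall>l<m. lookup w (lookup c l) = g l) \<and> agree A S (lookup w) n" for n
  proof -
    \<comment> \<open>The table covers the elements up to \<open>n\<close> for the agreement and the
      entries of \<open>c\<close> for the tuple.\<close>
    obtain w where w: "\<And>x. x < Suc (max n b) \<Longrightarrow> lookup w x = f x"
      using ex_lookup[of "Suc (max n b)" f] by blast
    have "lookup w (lookup c l) = g l" if "l < m" for l
      using w[of "lookup c l"] b[OF that] c[OF that] f(1) by (simp add: bij_is_surj surj_f_inv_f)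
    moreover have "agree A S (lookup w) n"
      unfolding f(2) using f(1) w by (intro agree_pull) (simp_all add: bij_is_inj)
    ultimately show ?thesis
      by blast
  qed
  then show ?thesis
    by blast
qed


section \<open>The learner\<close>

text \<open>Some \<open>b\<close> survives forever, so the least survivor never exceeds
  \<open>b\<close>. Each of the finitely many bad candidates up to \<open>b\<close> is refuted at
  some stage and stays refuted.\<close>

lemma eventually_Least:
  fixes Q :: "nat \<Rightarrow> nat \<Rightarrow> bool"
  assumes anti: "\<And>k n n'. n \<le> n' \<Longrightarrow> Q k n' \<Longrightarrow> Q k n"
    and ex: "\<exists>k. \<forall>n. Q k n"
    and good: "\<And>k. \<forall>n. Q k n \<Longrightarrow> P k"
  shows "\<forall>\<^sub>F n in sequentially. P (LEAST k. Q k n)"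
proof -
  obtain b where b: "\<And>n. Q b n"
    using ex by blast
  have "\<forall>\<^sub>F n in sequentially. \<not> Q k n" if "\<not> P k" for k
    using good[of k] that anti unfolding eventually_sequentially by blast
  then have "\<forall>\<^sub>F n in sequentially. \<forall>k \<in> {k. k \<le> b \<and> \<not> P k}. \<not> Q k n"
    by (intro eventually_ball_finite) simp_all
  then show ?thesis
  proof (rule eventually_mono)
    fix n assume "\<forall>k \<in> {k. k \<le> b \<and> \<not> P k}. \<not> Q k n"
    then show "P (LEAST k. Q k n)"
      using Least_le[of "\<lambda>k. Q k n", OF b] LeastI[of "\<lambda>k. Q k n", OF b] by blast
  qed
qed

theorem theorem3p1:
  fixes L :: rel_signature and K :: "struct set"
  assumes "computable_signature L"
    and "finite K"
    and "\<forall>A\<in>K. is_struct L A \<and> computable_struct A"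
    and "pairwise (\<lambda>A B. \<not> A \<cong> B) K"
    and "learnable L K"
  shows "learnable_by_computable_in halting_set L K"
proof -
  obtain M where M: "learns L K M"
    using assms(5) unfolding learnable_def by blast
  have lim: "\<forall>\<^sub>F n in sequentially. M (restr L S n) = Some A" if "A \<in> K" "S \<cong> A" for A S
    using M that unfolding learns_def LD_def by blast
  have same: "A = B" if "A \<in> K" "B \<in> K" "S \<cong> A" "S \<cong> B" for A B S
    using assms(4) that isomorphic_sym isomorphic_trans unfolding pairwise_def by blast
  obtain E where E: "bij_betw E {..<card K} K"
    using assms(2) ex_bij_betw_nat_finite[of K] by (auto simp: atLeast0LessThan)
  define r where "r = card K"
  have inj_E: "inj_on E {..<r}" and img: "E ` {..<r} = K"
    using E by (simp_all add: r_def bij_betw_def)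
  have E_mem: "E i \<in> K" if "i < r" for i
    using img that by blast
  \<comment> \<open>Only the number \<open>a\<close>, coding the first \<open>m\<close> values of
    \<open>g\<close>, enters the program; \<open>g\<close> itself may be noncomputable.\<close>
  have "\<exists>g m a. bij g \<and> locking L M (E i) g m \<and> (\<forall>l<m. lookup a l = g l)" if "i < r" for i
    using ex_locking[of "E i" M L] lim[OF E_mem[OF that]] ex_lookup by metis
  then obtain g m a where lock: "\<And>i. i < r \<Longrightarrow> bij (g i)" "\<And>i. i < r \<Longrightarrow> locking L M (E i) (g i) (m i)"
    and a: "\<And>i l. i < r \<Longrightarrow> l < m i \<Longrightarrow> lookup (a i) l = g i l"
    by metis
  \<comment> \<open>A candidate \<open>k\<close> codes a pair: the index of a family member and a
    tuple of the observed structure.\<close>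
  define index where "index k = fst (prod_decode k)" for k
  \<comment> \<open>\<open>x\<close> packs the candidate and the structure code, as
    \<open>halting_set\<close> concerns programs with one argument. The default 1 refutes candidates
    without a valid index.\<close>
  define R where "R w x = (if index (fst (prod_decode x)) < r
    then mismatch (E (index (fst (prod_decode x)))) (a (index (fst (prod_decode x))))
      (m (index (fst (prod_decode x)))) w (snd (prod_decode (fst (prod_decode x)))) (snd (prod_decode x))
    else 1)" for w x
  define Q where "Q k d \<longleftrightarrow> (\<exists>w. R w (prod_encode (k, d)) = 0)" for k d
  \<comment> \<open>On restrictions of structures in the learning domain the \<open>LEAST\<close> is
    attained, since there some candidate survives all stages.\<close>
  define N where "N D = Some (E (index (LEAST k. Q k (finite_struct_code D))))" for D
  define code where "code S n = finite_struct_code (restr L S n)" for S n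
  have struct: "is_struct L S" if "S \<in> LD K" for S
    using that assms(3) is_struct_isomorphic unfolding LD_def by blast
  have Q_iff: "Q k (code S n) \<longleftrightarrow> index k < r \<and> (\<exists>w. (\<forall>l<m (index k).
      lookup w (lookup (snd (prod_decode k)) l) = g (index k) l) \<and> agree (E (index k)) S (lookup w) n)"
    if "S \<in> LD K" for S k n
    using a mismatch_eq_0_iff[OF struct[OF that]] by (auto simp: Q_def R_def code_def)
  have ex: "\<exists>k. \<forall>n. Q k (code S n)" if S: "S \<in> LD K" for S
  proof -
    obtain A where "A \<in> K" "S \<cong> A"
      using S unfolding LD_def by blast
    then obtain i where i: "i < r" "S \<cong> E i"
      using img by auto
    obtain c where "\<forall>n. \<exists>w. (\<forall>l<m i. lookup w (lookup c l) = g i l) \<and> agree (E i) S (lookup w) n"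
      using locking_complete[OF lock(1) i(2)] i(1) by blast
    then show ?thesis
      using i(1) by (intro exI[of _ "prod_encode (i, c)"]) (simp add: Q_iff[OF S] index_def)
  qed
  have sound: "S \<cong> E (index k)" if S: "S \<in> LD K" and k: "\<forall>n. Q k (code S n)" for S k
  proof -
    have i: "index k < r"
      using k Q_iff[OF S] by blast
    obtain A where A: "A \<in> K" "S \<cong> A"
      using S unfolding LD_def by blast
    have "is_struct L (E (index k))"
      using assms(3) E_mem[OF i] by blast
    moreover have "\<exists>f. (\<forall>l<m (index k). f (lookup (snd (prod_decode k)) l) = g (index k) l) \<and>
        agree (E (index k)) S f n" for n
      using k Q_iff[OF S] by blast
    ultimately obtain T where T: "T \<cong> S" "\<forall>\<^sub>F n in sequentially. M (restr L T n) = Some (E (index k))"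
      using locking_sound[OF lock(2,1)[OF i] struct[OF S], where c = "lookup (snd (prod_decode k))"] by blast
    \<comment> \<open>On \<open>T\<close>, a copy of both \<open>S\<close> and \<open>A\<close>, the
      given learner converges to \<open>A\<close> by correctness and to \<open>E (index k)\<close>
      by locking, so these are equal.\<close>
    have "\<forall>\<^sub>F n in sequentially. M (restr L T n) = Some A"
      using lim[OF A(1)] isomorphic_trans[OF T(1) A(2)] by blast
    with T(2) have "\<forall>\<^sub>F n in sequentially. E (index k) = A"
      by eventually_elim simp
    then show ?thesis
      using A(2) by simp
  qed
  have anti: "Q k (code S n)" if "S \<in> LD K" "n \<le> n'" "Q k (code S n')" for S k n n'
    using that(3) agree_antimono[OF that(2)] unfolding Q_iff[OF that(1)] by blast
  have N_lim: "\<forall>\<^sub>F n in sequentially. \<exists>A\<in>K. N (restr L S n) = Some A \<and> S \<cong> A" if S: "S \<in> LD K" for S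
  proof -
    have "\<forall>\<^sub>F n in sequentially. (\<lambda>k. index k < r \<and> S \<cong> E (index k)) (LEAST k. Q k (code S n))"
    proof (rule eventually_Least)
      show "Q k (code S n)" if "n \<le> n'" "Q k (code S n')" for k n n'
        using anti[OF S that] .
      show "\<exists>k. \<forall>n. Q k (code S n)"
        using ex[OF S] .
      show "index k < r \<and> S \<cong> E (index k)" if "\<forall>n. Q k (code S n)" for k
        using sound[OF S that] that Q_iff[OF S] by blast
    qed
    then show ?thesis
      by eventually_elim (auto simp: N_def code_def E_mem)
  qed
  have least: "index (LEAST k. Q k (code S n)) < r" if S: "S \<in> LD K" for S n
    using LeastI_ex[of "\<lambda>k. Q k (code S n)"] ex[OF S] Q_iff[OF S] by blast
  have "is_learner L K N"
    using least E_mem by (auto simp: is_learner_def N_def HS_def code_def)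
  moreover have "learns L K N"
    unfolding learns_def
  proof (intro ballI iffI)
    fix S A assume S: "S \<in> LD K" and A: "A \<in> K"
    {
      assume "\<forall>\<^sub>F n in sequentially. N (restr L S n) = Some A"
      with N_lim[OF S] have "\<forall>\<^sub>F n in sequentially. S \<cong> A"
        by eventually_elim auto
      then show "S \<cong> A"
        by simp
    }
    assume "S \<cong> A"
    \<comment> \<open>A priori the member provided by \<open>N_lim\<close> may vary with
      \<open>n\<close>; \<open>same\<close> identifies it with \<open>A\<close>.\<close>
    with N_lim[OF S] show "\<forall>\<^sub>F n in sequentially. N (restr L S n) = Some A"
      using same[OF A] by (auto elim!: eventually_mono)
  qed
  moreover have "computable_learner_in halting_set L K N"
  proof -
    \<comment> \<open>Every member is numbered by its index, so the index found by the search is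
      itself the output; the question mark receives \<open>r\<close>, which is no index.\<close>
    define c where "c h = (case h of None \<Rightarrow> r | Some A \<Rightarrow> inv_into {..<r} E A)" for h
    have "inj_on c (HS K)"
    proof -
      have "inv_into {..<r} E A \<noteq> r" if "A \<in> K" for A
        using inv_into_into[of A E "{..<r}"] img that by auto
      moreover have "inj_on (inv_into {..<r} E) K"
        using inj_on_inv_into[of K E "{..<r}"] img by simp
      ultimately show ?thesis
        by (force simp: c_def HS_def inj_on_def)
    qed
    have "rcomp {} 2 (\<lambda>xs. R (xs ! 0) (xs ! 1))"
      unfolding R_def
    proof (rule rcomp_cases[where F = "\<lambda>i xs. mismatch (E i) (a i) (m i) (xs ! 0)
        (snd (prod_decode (fst (prod_decode (xs ! 1))))) (snd (prod_decode (xs ! 1)))"])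
      fix i assume "i < r"
      then have "computable_struct (E i)"
        using assms(3) E_mem by blast
      then show "rcomp {} 2 (\<lambda>xs. mismatch (E i) (a i) (m i) (xs ! 0)
          (snd (prod_decode (fst (prod_decode (xs ! 1))))) (snd (prod_decode (xs ! 1))))"
        by (intro rcomp_compose3[OF rcomp_mismatch] rcomp_snd rcomp_fst rcomp_nth) simp_all
    next
      show "rcomp {} 2 (\<lambda>xs. index (fst (prod_decode (xs ! 1))))"
        unfolding index_def by (intro rcomp_fst rcomp_nth) simp
    qed
    moreover have "rcomp halting_set 2 (\<lambda>xs. prod_encode (xs ! 0, xs ! 1))"
      by (intro rcomp_prod_encode rcomp_nth) simp_all
    ultimately have "rcomp halting_set 2 (\<lambda>xs. if Q (xs ! 0) (xs ! 1) then 1 else 0)"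
      unfolding Q_def by (rule rcomp_exists_zero)
    moreover have "rcomp halting_set 1 (\<lambda>xs. index (xs ! 0))"
      unfolding index_def by (rule rcomp_prod_decode)
    ultimately obtain p where p: "\<And>x. \<exists>k. Q k x \<Longrightarrow> run halting_set p [x] (index (LEAST k. Q k x))"
      using ex_run_Least by blast
    have "run halting_set p [code S n] (c (N (restr L S n)))" if S: "S \<in> LD K" for S n
    proof -
      have "c (N (restr L S n)) = index (LEAST k. Q k (code S n))"
        using inv_into_f_f[OF inj_E] least[OF S] by (simp add: c_def N_def code_def)
      then show ?thesis
        using p[of "code S n"] ex[OF S] by auto
    qed
    with \<open>inj_on c (HS K)\<close> show ?thesis
      unfolding computable_learner_in_def code_def by blast
  qed
  ultimately show ?thesis
    unfolding learnable_by_computable_in_def by blast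
qed

end
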